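(* Let $n\ge 2$, $k\in[n]$, and $\mathbf c\in\mathbb R^n$ with $c_1<\dots<c_n$. Let $P$ be a coherent monotone path on the hypersimplex $\Delta(n,k)$ with respect to $\mathbf c$. Then for every pair of enhanced steps $(i\to j;A)\prec(x\to y;Z)$ of $P$ with $x<j$, one has $j\in Z$ or $x\in A$.
   Context: $\Delta(n,k)=\{\mathbf x\in[0,1]^n:\sum_ix_i=k\}$; its vertices are the $0/1$-vectors with $k$ ones, $\operatorname{supp}(\mathbf v)=\{i:v_i=1\}$, and two vertices $\mathbf u,\mathbf v$ are adjacent iff $|\operatorname{supp}\mathbf u\cap\operatorname{supp}\mathbf v|=k-1$. A monotone path is a sequence of vertices $(\mathbf v_1,\dots,\mathbf v_r)$ with $\mathbf v_1=(1,\dots,1,0,\dots,0)$, $\mathbf v_r=(0,\dots,0,1,\dots,1)$, consecutive vertices adjacent and $\langle\mathbf v_i,\mathbf c\rangle<\langle\mathbf v_{i+1},\mathbf c\rangle$. Its $i$-th enhanced step is $(x\to y;Z)$ where $Z=\operatorname{supp}\mathbf v_i\cap\operatorname{supp}\mathbf v_{i+1}$, $\{x\}=\operatorname{supp}\mathbf v_i\setminus\operatorname{supp}\mathbf v_{i+1}$, $\{y\}=\operatorname{supp}\mathbf v_{i+1}\setminus\operatorname{supp}\mathbf v_i$; we write $s\prec s'$ if $s$ is the $i$-th and $s'$ the $j$-th enhanced step with $i<j$. For $\boldsymbol\omega\in\mathbb R^n$ let $\pi^{\boldsymbol\omega}(\mathbf x)=(\langle\mathbf x,\mathbf c\rangle,\langle\mathbf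 x,\boldsymbol\omega\rangle)$; a proper face of the polygon $\pi^{\boldsymbol\omega}(\Delta(n,k))$ is upper if it has an outer normal with positive second coordinate. $P$ is coherent if there is $\boldsymbol\omega$ such that the preimages in $\Delta(n,k)$ of the upper edges of $\pi^{\boldsymbol\omega}(\Delta(n,k))$ are exactly the edges $\mathbf v_i\mathbf v_{i+1}$ of $P$ (equivalently, $P$ corresponds to a vertex of the monotone path polytope of $(\Delta(n,k),\mathbf c)$). *)

theory Defs
  imports "HOL-Analysis.Analysis"
begin

(* The index set [n] is rendered by a finite linearly ordered type 'n with CARD('n) = n. *)

definition hypersimplex :: "nat \<Rightarrow> (real ^ 'n::finite) set" where
  "hypersimplex k = {x. (\<forall>i. 0 \<le> x $ i \<and> x $ i \<le> 1) \<and> (\<Sum>i\<in>UNIV. x $ i) = real k}"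

definition supp :: "real ^ 'n \<Rightarrow> 'n::finite set" where
  "supp v = {i. v $ i = 1}"

definition hypersimplex_vertices :: "nat \<Rightarrow> (real ^ 'n::finite) set" where
  "hypersimplex_vertices k = {v. (\<forall>i. v $ i = 0 \<or> v $ i = 1) \<and> card (supp v) = k}"

lemma hypersimplex_vertex_in:
  assumes "v \<in> hypersimplex_vertices k"
  shows "v \<in> hypersimplex k"
proof -
  have 01: "v $ i = (if i \<in> supp v then 1 else 0)" for i
    using assms by (auto simp: hypersimplex_vertices_def supp_def)
  have "(\<Sum>i\<in>UNIV. v $ i) = (\<Sum>i\<in>UNIV. if i \<in> supp v then 1 else 0)"
    by (rule sum.cong) (use 01 in auto)
  also have "\<dots> = real k"
    using assms by (simp add: sum.If_cases hypersimplex_vertices_def)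
  finally show ?thesis
    using 01 by (simp add: hypersimplex_def)
qed

lemma hypersimplex_vertices_eq_extreme_points:
  "hypersimplex_vertices k = {v. v extreme_point_of hypersimplex k}"
proof (intro equalityI subsetI CollectI)
  fix v :: "real ^ 'n" assume v: "v \<in> hypersimplex_vertices k"
  have "a = b" if ab: "a \<in> hypersimplex k" "b \<in> hypersimplex k" "v \<in> open_segment a b" for a b
  proof -
    from ab(3) obtain u where u: "0 < u" "u < 1" "v = (1 - u) *\<^sub>R a + u *\<^sub>R b"
      by (auto simp: in_segment)
    have "a $ i = b $ i" for i
    proof -
      have e: "v $ i = (1 - u) * a $ i + u * b $ i" using u by simp
      have r: "0 \<le> a $ i" "a $ i \<le> 1" "0 \<le> b $ i" "b $ i \<le> 1"
        using ab by (auto simp: hypersimplex_def)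
      consider "v $ i = 0" | "v $ i = 1" using v by (auto simp: hypersimplex_vertices_def)
      then show ?thesis
      proof cases
        case 1
        have "0 \<le> (1 - u) * a $ i" "0 \<le> u * b $ i" using u r by auto
        then have "(1 - u) * a $ i = 0" "u * b $ i = 0" using e 1 by linarith+
        then show ?thesis using u by simp
      next
        case 2
        have "0 \<le> (1 - u) * (1 - a $ i)" "0 \<le> u * (1 - b $ i)" using u r by auto
        moreover have "(1 - u) * (1 - a $ i) + u * (1 - b $ i) = 0"
          using e 2 by (simp add: algebra_simps)
        ultimately have "(1 - u) * (1 - a $ i) = 0" "u * (1 - b $ i) = 0" by linarith+
        then show ?thesis using u by simp
      qed
    qed
    then show ?thesis by (simp add: vec_eq_iff)
  qed
  then show "v extreme_point_of hypersimplex k"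
    using hypersimplex_vertex_in[OF v] by (force simp: extreme_point_of_def)
next
  fix v :: "real ^ 'n" assume "v \<in> {v. v extreme_point_of hypersimplex k}"
  then have v: "v \<in> hypersimplex k"
    and ext: "\<And>a b. a \<in> hypersimplex k \<Longrightarrow> b \<in> hypersimplex k \<Longrightarrow> v \<notin> open_segment a b"
    by (auto simp: extreme_point_of_def)
  have r: "0 \<le> v $ i" "v $ i \<le> 1" for i using v by (auto simp: hypersimplex_def)
  have sm: "(\<Sum>i\<in>UNIV. v $ i) = real k" using v by (auto simp: hypersimplex_def)
  have 01: "v $ i = 0 \<or> v $ i = 1" for i
  proof (rule ccontr)
    assume "\<not> (v $ i = 0 \<or> v $ i = 1)"
    then have i: "0 < v $ i" "v $ i < 1" using r[of i] by auto
    have "\<exists>l. l \<noteq> i \<and> v $ l \<noteq> 0 \<and> v $ l \<noteq> 1"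
    proof (rule ccontr)
      assume "\<not> ?thesis"
      then have "(\<Sum>l\<in>UNIV - {i}. v $ l) = (\<Sum>l\<in>UNIV - {i}. of_int \<lfloor>v $ l\<rfloor>)"
        by (intro sum.cong) auto
      then have "(\<Sum>l\<in>UNIV - {i}. v $ l) \<in> \<int>" by (metis Ints_of_int Ints_sum)
      moreover have "v $ i = real k - (\<Sum>l\<in>UNIV - {i}. v $ l)"
        using sm by (simp add: sum.remove[of UNIV i])
      ultimately have "v $ i \<in> \<int>" by simp
      then show False using i by (auto elim!: Ints_cases)
    qed
    then obtain l where l: "l \<noteq> i" "0 < v $ l" "v $ l < 1"
      using r by (metis order_le_less)
    define e where "e = Min {v $ i, 1 - v $ i, v $ l, 1 - v $ l}"
    have e: "0 < e" "e \<le> v $ i" "e \<le> 1 - v $ i" "e \<le> v $ l" "e \<le> 1 - v $ l"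
      using i l by (auto simp: e_def)
    define d where "d = axis i e - axis l e"
    have dn: "d $ h = (if h = i then e else if h = l then - e else 0)" for h
      using l by (auto simp: d_def axis_def)
    have sd: "(\<Sum>h\<in>UNIV. d $ h) = 0"
      by (simp add: d_def axis_def sum_subtractf)
    have m: "v + d \<in> hypersimplex k" "v - d \<in> hypersimplex k"
      using e r sm sd dn by (auto simp: hypersimplex_def sum.distrib sum_subtractf)
    have "d $ i \<noteq> 0" using dn e by simp
    then have "v - d \<noteq> v + d" by (auto simp: vec_eq_iff intro!: exI[of _ i])
    moreover have "v = (1 - 1/2) *\<^sub>R (v - d) + (1/2) *\<^sub>R (v + d)"
      by (simp add: vec_eq_iff field_simps)
    ultimately have "v \<in> open_segment (v - d) (v + d)"
      unfolding in_segment by (intro conjI exI[of _ "1/2"]) auto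
    then show False using ext m by blast
  qed
  have "(\<Sum>i\<in>UNIV. v $ i) = (\<Sum>i\<in>UNIV. if i \<in> supp v then 1 else 0)"
    by (rule sum.cong) (use 01 in \<open>auto simp: supp_def\<close>)
  then have "card (supp v) = k"
    using sm by (simp add: sum.If_cases)
  then show "v \<in> hypersimplex_vertices k" using 01 by (simp add: hypersimplex_vertices_def)
qed

definition adjacent :: "nat \<Rightarrow> real ^ 'n \<Rightarrow> real ^ 'n::finite \<Rightarrow> bool" where
  "adjacent k u v \<longleftrightarrow>
     u \<in> hypersimplex_vertices k \<and> v \<in> hypersimplex_vertices k \<and> card (supp u \<inter> supp v) = k - 1"

definition first_vertex :: "nat \<Rightarrow> real ^ 'n::{finite,linorder}" where
  "first_vertex k = (\<chi> i. if card {j. j < i} < k then 1 else 0)"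

definition last_vertex :: "nat \<Rightarrow> real ^ 'n::{finite,linorder}" where
  "last_vertex k = (\<chi> i. if card {j. i < j} < k then 1 else 0)"

(* A path (v_1, ..., v_r) is the list P of length r with v_i = P ! (i - 1). *)

definition monotone_path ::
  "nat \<Rightarrow> real ^ 'n::{finite,linorder} \<Rightarrow> (real ^ 'n::{finite,linorder}) list \<Rightarrow> bool" where
  "monotone_path k c P \<longleftrightarrow>
     P \<noteq> [] \<and> set P \<subseteq> hypersimplex_vertices k \<and>
     hd P = first_vertex k \<and> last P = last_vertex k \<and>
     (\<forall>a. Suc a < length P \<longrightarrow>
        adjacent k (P ! a) (P ! Suc a) \<and> P ! a \<bullet> c < P ! Suc a \<bullet> c)"

(* The triple (x, y, Z) encodes the enhanced step (x \<rightarrow> y; Z). *)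

definition is_enhanced_step ::
  "(real ^ 'n::finite) list \<Rightarrow> nat \<Rightarrow> 'n \<times> 'n \<times> 'n set \<Rightarrow> bool" where
  "is_enhanced_step P a s \<longleftrightarrow> Suc a < length P \<and>
     (case s of (x, y, Z) \<Rightarrow>
        Z = supp (P ! a) \<inter> supp (P ! Suc a) \<and>
        {x} = supp (P ! a) - supp (P ! Suc a) \<and>
        {y} = supp (P ! Suc a) - supp (P ! a))"

definition step_precedes ::
  "(real ^ 'n::finite) list \<Rightarrow> 'n \<times> 'n \<times> 'n set \<Rightarrow> 'n \<times> 'n \<times> 'n set \<Rightarrow> bool" where
  "step_precedes P s s' \<longleftrightarrow>
     (\<exists>a b. a < b \<and> is_enhanced_step P a s \<and> is_enhanced_step P b s')"

definition proj :: "real ^ 'n \<Rightarrow> real ^ 'n \<Rightarrow> real ^ 'n::finite \<Rightarrow> real \<times> real" where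
  "proj c \<omega> x = (x \<bullet> c, x \<bullet> \<omega>)"

definition outer_normal :: "(real \<times> real) set \<Rightarrow> (real \<times> real) set \<Rightarrow> real \<times> real \<Rightarrow> bool" where
  "outer_normal Q F m \<longleftrightarrow> m \<noteq> 0 \<and> F = {p \<in> Q. \<forall>q\<in>Q. m \<bullet> q \<le> m \<bullet> p}"

definition upper_face :: "(real \<times> real) set \<Rightarrow> (real \<times> real) set \<Rightarrow> bool" where
  "upper_face Q F \<longleftrightarrow> F face_of Q \<and> F \<noteq> Q \<and> (\<exists>m. outer_normal Q F m \<and> 0 < snd m)"

(* Only proper faces are upper, so a polygon degenerating to a segment has no upper edge.
   Among the hypersimplices of positive dimension this matters only for n = 2, k = 1,
   where the unique monotone path has a single step. *)

definition coherent :: "nat \<Rightarrow> real ^ 'n::{finite,linorder} \<Rightarrow> (real ^ 'n::{finite,linorder}) list \<Rightarrow> bool" where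
  "coherent k c P \<longleftrightarrow> (\<exists>\<omega>.
     {{x \<in> hypersimplex k. proj c \<omega> x \<in> F} | F.
        F edge_of proj c \<omega> ` hypersimplex k \<and> upper_face (proj c \<omega> ` hypersimplex k) F} =
     {closed_segment (P ! a) (P ! Suc a) | a. Suc a < length P})"

end

theory Submission
  imports Defs
begin

text \<open>Let \<open>\<sigma>\<close> and \<open>\<tau>\<close> be the slopes of the upper edges above the two steps. Concavity of the
  upper boundary gives \<open>\<tau> < \<sigma>\<close>. If \<open>x \<notin> A\<close>, exchanging \<open>j\<close> for \<open>x\<close> in the target of the first step
  shows \<open>\<omega>\<^sub>x - \<sigma> c\<^sub>x \<le> \<omega>\<^sub>j - \<sigma> c\<^sub>j\<close>; if \<open>j \<notin> Z\<close>, exchanging \<open>x\<close> for \<open>j\<close> in the source of the second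
  step shows \<open>\<omega>\<^sub>j - \<tau> c\<^sub>j \<le> \<omega>\<^sub>x - \<tau> c\<^sub>x\<close>. Adding the two contradicts \<open>c\<^sub>x < c\<^sub>j\<close>.\<close>

lemma exchange_in_hypersimplex:
  fixes v :: "real ^ 'n::finite"
  assumes v: "v \<in> hypersimplex_vertices k" and p: "p \<in> supp v" and q: "q \<notin> supp v"
  shows "v + axis q 1 - axis p 1 \<in> hypersimplex k"
proof -
  have "v \<in> hypersimplex k" by (rule hypersimplex_vertex_in[OF v])
  moreover have "v $ p = 1" "v $ q = 0" "p \<noteq> q"
    using assms by (auto simp: supp_def hypersimplex_vertices_def)
  moreover have "(\<Sum>h\<in>UNIV. axis q (1::real) $ h) = 1" "(\<Sum>h\<in>UNIV. axis p (1::real) $ h) = 1"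
    by (simp_all add: axis_def)
  ultimately show ?thesis
    by (auto simp: hypersimplex_def sum.distrib sum_subtractf axis_def)
qed

text \<open>Replacing \<open>p\<close> by \<open>q\<close> in the support of \<open>v\<close>
  changes the value of \<open>w\<close> by \<open>w $ q - w $ p\<close>, which cannot be positive at
  a maximizer.\<close>

lemma exchange_le:
  fixes v :: "real ^ 'n::finite"
  assumes v: "v \<in> hypersimplex_vertices k" and p: "p \<in> supp v" and q: "q \<notin> supp v"
    and max: "\<And>z. z \<in> hypersimplex k \<Longrightarrow> z \<bullet> w \<le> v \<bullet> w"
  shows "w $ q \<le> w $ p"
  using max[OF exchange_in_hypersimplex[OF v p q]]
  by (simp add: inner_diff_left inner_add_left inner_axis_axis inner_axis')

text \<open>An outer normal with positive second coordinate can be rescaled to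
  \<open>(- \<sigma>, 1)\<close>. Pulled back along \<open>proj c \<omega>\<close>, it becomes the
  linear functional \<open>\<omega> - \<sigma> *\<^sub>R c\<close>, so the preimage of the face is
  the set of its maximizers on \<open>S\<close>.\<close>

lemma upper_face_slope:
  fixes c \<omega> :: "real ^ 'n::finite"
  assumes "upper_face (proj c \<omega> ` S) F"
  obtains \<sigma> where "{z \<in> S. proj c \<omega> z \<in> F} =
    {z \<in> S. \<forall>z'\<in>S. z' \<bullet> (\<omega> - \<sigma> *\<^sub>R c) \<le> z \<bullet> (\<omega> - \<sigma> *\<^sub>R c)}"
proof -
  obtain m where m: "0 < snd m"
    and F: "F = {p \<in> proj c \<omega> ` S. \<forall>q\<in>proj c \<omega> ` S. m \<bullet> q \<le> m \<bullet> p}"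
    using assms unfolding upper_face_def outer_normal_def by blast
  \<comment> \<open>This is the slope of the lines orthogonal to \<open>m\<close>.\<close>
  define \<sigma> where "\<sigma> = - fst m / snd m"
  have "m \<bullet> proj c \<omega> z = snd m * (z \<bullet> (\<omega> - \<sigma> *\<^sub>R c))" for z
    using m by (simp add: proj_def inner_prod_def inner_diff_right inner_add_right \<sigma>_def field_simps)
  then have "{z \<in> S. proj c \<omega> z \<in> F} =
    {z \<in> S. \<forall>z'\<in>S. z' \<bullet> (\<omega> - \<sigma> *\<^sub>R c) \<le> z \<bullet> (\<omega> - \<sigma> *\<^sub>R c)}"
    using m by (auto simp: F)
  then show ?thesis by (rule that)
qed

text \<open>Each edge of the path is the preimage of an upper edge and so receives a slope, while a
  single \<open>\<omega>\<close> serves all of them.\<close>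

lemma coherent_slopes:
  fixes c :: "real ^ 'n::{finite,linorder}"
  assumes "coherent k c P"
  obtains \<omega> and \<sigma> :: "nat \<Rightarrow> real" where
    "\<And>a. Suc a < length P \<Longrightarrow> closed_segment (P ! a) (P ! Suc a) =
      {z \<in> hypersimplex k. \<forall>z'\<in>hypersimplex k.
        z' \<bullet> (\<omega> - \<sigma> a *\<^sub>R c) \<le> z \<bullet> (\<omega> - \<sigma> a *\<^sub>R c)}"
proof -
  obtain \<omega> where \<omega>:
    "{{x \<in> hypersimplex k. proj c \<omega> x \<in> F} | F.
        F edge_of proj c \<omega> ` hypersimplex k \<and> upper_face (proj c \<omega> ` hypersimplex k) F} =
     {closed_segment (P ! a) (P ! Suc a) | a. Suc a < length P}"
    using assms unfolding coherent_def by blast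
  \<comment> \<open>The bound on \<open>a\<close> stays inside the existential so that choice yields
    a total function; its values beyond the last edge are arbitrary.\<close>
  have ex: "\<exists>\<sigma>. Suc a < length P \<longrightarrow> closed_segment (P ! a) (P ! Suc a) =
      {z \<in> hypersimplex k. \<forall>z'\<in>hypersimplex k. z' \<bullet> (\<omega> - \<sigma> *\<^sub>R c) \<le> z \<bullet> (\<omega> - \<sigma> *\<^sub>R c)}" for a
  proof (cases "Suc a < length P")
    case True
    then have "closed_segment (P ! a) (P ! Suc a) \<in>
      {closed_segment (P ! a) (P ! Suc a) | a. Suc a < length P}" by blast
    then obtain F where F: "closed_segment (P ! a) (P ! Suc a) = {x \<in> hypersimplex k. proj c \<omega> x \<in> F}"
      "upper_face (proj c \<omega> ` hypersimplex k) F"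
      unfolding \<omega>[symmetric] by blast
    show ?thesis by (rule upper_face_slope[OF F(2)]) (auto simp: F(1))
  qed simp
  from choice[OF allI[OF ex]] show ?thesis
  proof (rule exE)
    fix \<sigma>
    assume *: "\<forall>a. Suc a < length P \<longrightarrow> closed_segment (P ! a) (P ! Suc a) =
      {z \<in> hypersimplex k. \<forall>z'\<in>hypersimplex k. z' \<bullet> (\<omega> - \<sigma> a *\<^sub>R c) \<le> z \<bullet> (\<omega> - \<sigma> a *\<^sub>R c)}"
    show ?thesis by (rule that[of \<omega> \<sigma>]) (rule *[rule_format])
  qed
qed

lemma monotone_path_inner_less:
  assumes P: "monotone_path k c P" and ab: "a < b" "b < length P"
  shows "P ! a \<bullet> c < P ! b \<bullet> c"
proof -
  have "transp (\<lambda>u v. u \<bullet> c < v \<bullet> c)" by (auto intro: transpI)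
  then have "sorted_wrt (\<lambda>u v. u \<bullet> c < v \<bullet> c) P"
    using P by (simp add: sorted_wrt_iff_nth_Suc_transp monotone_path_def)
  then show ?thesis using ab by (simp add: sorted_wrt_iff_nth_less)
qed

theorem theorem3p1:
  fixes c :: "real ^ 'n::{finite,linorder}"
    and k :: nat
    and P :: "(real ^ 'n::{finite,linorder}) list"
    and i j x y :: 'n
    and A Z :: "'n set"
  assumes "2 \<le> CARD('n)"
    and "1 \<le> k" and "k \<le> CARD('n)"
    and "strict_mono (\<lambda>i. c $ i)"
    and "monotone_path k c P"
    and "coherent k c P"
    and "step_precedes P (i, j, A) (x, y, Z)"
    and "x < j"
  shows "j \<in> Z \<or> x \<in> A"
proof (rule ccontr)
  assume neg: "\<not> (j \<in> Z \<or> x \<in> A)"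
  obtain a b where ab: "a < b" "Suc a < length P" "Suc b < length P"
    and A: "A = supp (P ! a) \<inter> supp (P ! Suc a)" "{j} = supp (P ! Suc a) - supp (P ! a)"
    and Z: "Z = supp (P ! b) \<inter> supp (P ! Suc b)" "{x} = supp (P ! b) - supp (P ! Suc b)"
    using assms(7) unfolding step_precedes_def is_enhanced_step_def by auto
  obtain \<omega> and \<sigma> :: "nat \<Rightarrow> real" where seg:
    "\<And>a. Suc a < length P \<Longrightarrow> closed_segment (P ! a) (P ! Suc a) =
      {z \<in> hypersimplex k. \<forall>z'\<in>hypersimplex k.
        z' \<bullet> (\<omega> - \<sigma> a *\<^sub>R c) \<le> z \<bullet> (\<omega> - \<sigma> a *\<^sub>R c)}"
    using coherent_slopes[OF assms(6)] by blast
  have vert: "P ! h \<in> hypersimplex_vertices k" if "h < length P" for h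
    using assms(5) that by (auto simp: monotone_path_def)
  note hyp = hypersimplex_vertex_in[OF vert]
  have max0: "z \<bullet> (\<omega> - \<sigma> h *\<^sub>R c) \<le> P ! h \<bullet> (\<omega> - \<sigma> h *\<^sub>R c)"
    if "Suc h < length P" "z \<in> hypersimplex k" for h z
    using seg[OF that(1)] ends_in_segment(1)[of "P ! h" "P ! Suc h"] that(2) by blast
  have max1: "z \<bullet> (\<omega> - \<sigma> h *\<^sub>R c) \<le> P ! Suc h \<bullet> (\<omega> - \<sigma> h *\<^sub>R c)"
    if "Suc h < length P" "z \<in> hypersimplex k" for h z
    using seg[OF that(1)] ends_in_segment(2)[of "P ! Suc h" "P ! h"] that(2) by blast

  \<comment> \<open>Concavity is tested on two vertices only, the start \<open>?p\<close> of the
    first edge and the end \<open>?q\<close> of the second. For slope \<open>\<sigma> a\<close> the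
    maximizer \<open>?p\<close> strictly beats \<open>?q\<close>; for slope
    \<open>\<sigma> b\<close> the vertex \<open>?q\<close> is a maximizer.\<close>
  have slope: "\<sigma> b < \<sigma> a"
  proof -
    let ?p = "P ! a" and ?q = "P ! Suc b"
    have pq: "?p \<bullet> c < ?q \<bullet> c"
      using monotone_path_inner_less[OF assms(5)] ab by simp
    \<comment> \<open>The strictness comes from here: \<open>?q\<close> has a larger
      \<open>c\<close>-value than every point of the first edge, hence lies off that edge and is no
      maximizer for slope \<open>\<sigma> a\<close>.\<close>
    have "z \<bullet> c \<le> P ! Suc a \<bullet> c" if z: "z \<in> closed_segment ?p (P ! Suc a)" for z
    proof -
      obtain u where u: "0 \<le> u" "u \<le> 1" "z = (1 - u) *\<^sub>R ?p + u *\<^sub>R P ! Suc a"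
        using z by (auto simp: in_segment)
      have "?p \<bullet> c \<le> P ! Suc a \<bullet> c"
        using monotone_path_inner_less[OF assms(5), of a "Suc a"] ab by simp
      then have "(1 - u) * (?p \<bullet> c) \<le> (1 - u) * (P ! Suc a \<bullet> c)"
        using u by (intro mult_left_mono) auto
      then show ?thesis unfolding u(3) inner_add_left inner_scaleR_left by (simp add: algebra_simps)
    qed
    moreover have "P ! Suc a \<bullet> c < ?q \<bullet> c"
      using monotone_path_inner_less[OF assms(5)] ab by simp
    ultimately have "?q \<notin> closed_segment ?p (P ! Suc a)" by force
    then obtain z where "z \<in> hypersimplex k" "?q \<bullet> (\<omega> - \<sigma> a *\<^sub>R c) < z \<bullet> (\<omega> - \<sigma> a *\<^sub>R c)"
      unfolding seg[OF ab(2)] using hyp[OF ab(3)] by (auto simp: not_le)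
    then have "?q \<bullet> (\<omega> - \<sigma> a *\<^sub>R c) < ?p \<bullet> (\<omega> - \<sigma> a *\<^sub>R c)"
      using max0[OF ab(2)] by fastforce
    moreover have "?p \<bullet> (\<omega> - \<sigma> b *\<^sub>R c) \<le> ?q \<bullet> (\<omega> - \<sigma> b *\<^sub>R c)"
      using max1[OF ab(3) hyp] ab by simp
    \<comment> \<open>The terms with \<open>\<omega>\<close> cancel when the two comparisons are
      added.\<close>
    ultimately have "\<sigma> b * (?q \<bullet> c - ?p \<bullet> c) < \<sigma> a * (?q \<bullet> c - ?p \<bullet> c)"
      by (simp add: inner_diff_right algebra_simps)
    then show ?thesis using pq by simp
  qed

  have jx: "j \<noteq> x" using \<open>x < j\<close> by simp
  have j_iff: "h \<in> supp (P ! Suc a) - supp (P ! a) \<longleftrightarrow> h = j" for h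
    unfolding A(2)[symmetric] by (rule singleton_iff)
  have x_iff: "h \<in> supp (P ! b) - supp (P ! Suc b) \<longleftrightarrow> h = x" for h
    unfolding Z(2)[symmetric] by (rule singleton_iff)
  \<comment> \<open>The target of the first step has support \<open>A\<close> together with
    \<open>j\<close>, and the source of the second has support \<open>Z\<close> together with
    \<open>x\<close>.\<close>
  have ja: "j \<in> supp (P ! Suc a)" and xa: "x \<notin> supp (P ! Suc a)"
    using j_iff[of j] j_iff[of x] A(1) neg jx by auto
  have xb: "x \<in> supp (P ! b)" and jb: "j \<notin> supp (P ! b)"
    using x_iff[of x] x_iff[of j] Z(1) neg jx by auto
  have "(\<omega> - \<sigma> a *\<^sub>R c) $ x \<le> (\<omega> - \<sigma> a *\<^sub>R c) $ j"
    by (rule exchange_le[OF vert[OF ab(2)] ja xa max1[OF ab(2)]])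
  moreover have "(\<omega> - \<sigma> b *\<^sub>R c) $ j \<le> (\<omega> - \<sigma> b *\<^sub>R c) $ x"
    by (rule exchange_le[OF vert[OF Suc_lessD[OF ab(3)]] xb jb max0[OF ab(3)]])
  ultimately have "(\<sigma> a - \<sigma> b) * (c $ j - c $ x) \<le> 0"
    by (simp add: algebra_simps)
  moreover have "0 < (\<sigma> a - \<sigma> b) * (c $ j - c $ x)"
    using slope strict_monoD[OF assms(4) \<open>x < j\<close>] by simp
  ultimately show False by simp
qed

end
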